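(* Let $d>2$ be an integer. There is a constant $C_d$ such that for every integer $n\ge 2$ and every set $\mathcal{O}$ of obstructing unit $d$-hypercubes in $[0,n]^d$, the number of hypercubes in $\mathcal{O}$ that are visible from the observer hypercube $[0,1]^d$, in the setting where light fails to interact with any obstruction that does not block it at the angle $45^\circ$, is at most $C_d\,n^{d-\frac1d}\log n$.
   Context: The hypercube $[0,n]^d$ is partitioned into axis-aligned unit $d$-hypercubes $\prod_{i=1}^d[a_i,a_i+1]$ with $a_i\in\{0,\dots,n-1\}$. The observer is the unit hypercube $[0,1]^d$ at the origin; a set $\mathcal{O}$ of other unit hypercubes of the partition is declared obstructing. A $d$-dimensional hypercube blocks a ray of light at the angle $\theta$ if the ray intersects some $(d-1)$-dimensional facet of the hypercube at an angle at most $90^\circ-\theta$ away from the normal vector (line) to that facet. In the setting of the theorem, light passes freely through any obstruction which does not block it at the angle $45^\circ$. Precisely, an obstructing hypercube $Q\in\mathcal{O}$ is visible if there are a point $x$ of the observer hypercube and a point $y\neq x$ on some facet $F$ of $Q$ such that the direction of the segment from $x$ to $y$ makes an angle at most $45^\circ$ with the normal line of $F$, and such that, apart from the point $y$, the segment from $x$ to $y$ meets no facet $F'$ of a hypercube $Q'\in\mathcal{O}$, $Q'\ne Q$, for which the direction of the segment makes an angle at most $45^\circ$ with the normal line of $F'$. *)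

theory Defs
  imports "HOL-Analysis.Analysis"
begin

definition unit_cube :: "nat ^ 'd \<Rightarrow> (real ^ 'd) set" where
  "unit_cube a = cbox (\<chi> i. real (a $ i)) (\<chi> i. real (a $ i) + 1)"

definition cube_partition :: "nat \<Rightarrow> (real ^ 'd) set set" where
  "cube_partition n = {unit_cube a | a. \<forall>i. a $ i < n}"

definition observer_cube :: "(real ^ 'd) set" where
  "observer_cube = unit_cube 0"

definition vec_angle :: "'a::real_inner \<Rightarrow> 'a \<Rightarrow> real" where
  "vec_angle u v = arccos (u \<bullet> v / (norm u * norm v))"

definition normal_vector :: "'a::real_inner set \<Rightarrow> 'a \<Rightarrow> bool" where
  "normal_vector F u \<longleftrightarrow> u \<noteq> 0 \<and> (\<forall>p\<in>F. \<forall>q\<in>F. orthogonal u (p - q))"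

text \<open>The angle is measured to the normal line, not to an oriented normal: both \<open>u\<close> and \<open>-u\<close> are
  normal vectors of \<open>F\<close>, so the existential picks the smaller of the two angles.\<close>

definition facet_blocks_direction :: "real \<Rightarrow> 'a::real_inner set \<Rightarrow> 'a \<Rightarrow> bool" where
  "facet_blocks_direction \<theta> F v \<longleftrightarrow> (\<exists>u. normal_vector F u \<and> vec_angle v u \<le> pi / 2 - \<theta>)"

definition visible ::
    "real \<Rightarrow> (real ^ 'd) set set \<Rightarrow> (real ^ 'd) set \<Rightarrow> bool" where
  "visible \<theta> Obs Q \<longleftrightarrow>
     (\<exists>x y F. x \<in> observer_cube \<and> F facet_of Q \<and> y \<in> F \<and> y \<noteq> x \<and>
        facet_blocks_direction \<theta> F (y - x) \<and>
        (\<forall>Q'\<in>Obs - {Q}. \<forall>F'. F' facet_of Q' \<and> facet_blocks_direction \<theta> F' (y - x) \<longrightarrow>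
           (closed_segment x y - {y}) \<inter> F' = {}))"

end

(*
  A ray can only be blocked by facets perpendicular to its dominant axis t, so the obstructions are
  unit cells in horizontal layers. Sort the visible cells into n^(d-1) buckets by the slopes of their
  rays, rounded to multiples of 1/n, and by the half of the cell that is hit in each coordinate.
  Among nearby cells of one bucket, a cell cannot lie below another one and be displaced towards the
  nearer side in all coordinates, since it would block the other one's ray: the cells form an
  antichain in a box of Z^d. If no lattice vector is resonant with the slope at scale 1/m, different
  cells lie in different boxes of an m x ... x m subdivision, and an antichain of boxes has
  O(m^(d-1)) members. Only O(n^d / m^d) slopes are resonant at scale 1/m, and summing over m gives
  O(n^(d-1/d)), the main contribution coming from m of order n^(1/d).
*)
theory Submission
  imports Defs
begin

section \<open>Facets of cubes and rays\<close>

lemma mem_unit_cube: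
  "x \<in> unit_cube a \<longleftrightarrow> (\<forall>i. real (a $ i) \<le> x $ i \<and> x $ i \<le> real (a $ i) + 1)"
  by (simp add: unit_cube_def mem_box_cart)

lemma unit_cube_eq_iff [simp]: "unit_cube a = unit_cube b \<longleftrightarrow> a = b"
proof
  have le: "b $ i \<le> a $ i" if "unit_cube a \<subseteq> unit_cube b" for a b :: "nat ^ 'd" and i
  proof -
    have "(\<chi> i. real (a $ i)) \<in> unit_cube b"
      using that by (rule subsetD) (simp add: mem_unit_cube)
    then show ?thesis
      by (simp add: mem_unit_cube)
  qed
  assume "unit_cube a = unit_cube b"
  then show "a = b"
    by (simp add: vec_eq_iff le order_antisym)
qed simp

text \<open>A hyperplane cut with an open set that it meets keeps its dimension, so it suffices to
  fit such a piece into the slice.\<close>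

lemma aff_dim_unit_cube_slice:
  fixes a :: "nat ^ 'd"
  assumes "r \<in> {real (a $ t), real (a $ t) + 1}"
  shows "aff_dim (unit_cube a \<inter> {x. x $ t = r}) = int CARD('d) - 1"
proof -
  let ?H = "{x :: real ^ 'd. x $ t = r}"
  have H: "?H = {x. axis t 1 \<bullet> x = r}"
    by (simp add: inner_axis')
  \<comment> \<open>The box extends by 1 to both sides of \<open>r\<close> in direction
    \<open>t\<close>, so that the hyperplane crosses its interior; elsewhere it is the open unit
    interval.\<close>
  let ?T = "box (\<chi> i. if i = t then r - 1 else real (a $ i))
      (\<chi> i. if i = t then r + 1 else real (a $ i) + 1)"
  have "(\<chi> i. if i = t then r else real (a $ i) + 1 / 2) \<in> ?H \<inter> ?T"
    by (auto simp: mem_box_cart)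
  then have "aff_dim (?H \<inter> ?T) = aff_dim ?H"
    by (intro aff_dim_convex_Int_open) (auto simp: H convex_hyperplane)
  moreover have "?H \<inter> ?T \<subseteq> unit_cube a \<inter> ?H"
  proof
    fix x assume x: "x \<in> ?H \<inter> ?T"
    have "real (a $ i) \<le> x $ i \<and> x $ i \<le> real (a $ i) + 1" for i
    proof (cases "i = t")
      case False
      then show ?thesis
        using x by (auto simp: mem_box_cart less_imp_le dest!: spec[of _ i])
    qed (use x assms in auto)
    then show "x \<in> unit_cube a \<inter> ?H"
      using x by (simp add: mem_unit_cube)
  qed
  then have "aff_dim (?H \<inter> ?T) \<le> aff_dim (unit_cube a \<inter> ?H)"
    by (rule aff_dim_subset)
  moreover have "aff_dim (unit_cube a \<inter> ?H) \<le> aff_dim ?H"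
    by (intro aff_dim_subset) auto
  moreover have "aff_dim ?H = int CARD('d) - 1"
    unfolding H by (subst aff_dim_hyperplane) (auto simp: axis_eq_0_iff)
  ultimately show ?thesis
    by linarith
qed

lemma aff_dim_unit_cube: "aff_dim (unit_cube (a :: nat ^ 'd)) = int CARD('d)"
proof -
  have "box (\<chi> i. real (a $ i)) (\<chi> i. real (a $ i) + 1) \<noteq> {}"
    by (simp add: interval_ne_empty_cart)
  then have "interior (unit_cube a) \<noteq> {}"
    by (simp add: unit_cube_def)
  then show ?thesis
    using aff_dim_nonempty_interior by fastforce
qed

text \<open>A facet is cut out by a supporting hyperplane with normal \<open>w\<close>. If
  \<open>w $ t\<close> is nonzero, pushing a facet point in direction \<open>t\<close> to the side
  favoured by \<open>w\<close> would exceed the support value unless the point already lies there.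
  So the facet lies in a slice, and equal dimensions make them equal.\<close>

lemma facet_of_unit_cube:
  fixes a :: "nat ^ 'd"
  shows "F facet_of unit_cube a \<longleftrightarrow>
    (\<exists>t. \<exists>r \<in> {real (a $ t), real (a $ t) + 1}. F = unit_cube a \<inter> {x. x $ t = r})"
proof
  have slice: "unit_cube a \<inter> {x. x $ t = r} face_of unit_cube a"
    if "r \<in> {real (a $ t), real (a $ t) + 1}" for t r
  proof -
    have conv: "convex (unit_cube a)"
      by (simp add: unit_cube_def)
    have "{x :: real ^ 'd. x $ t = r} = {x. axis t 1 \<bullet> x = r}"
      by (simp add: inner_axis')
    moreover have "unit_cube a \<inter> {x. axis t 1 \<bullet> x = r} face_of unit_cube a"
    proof (cases "r = real (a $ t)")
      case True
      show ?thesis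
        by (rule face_of_Int_supporting_hyperplane_ge[OF conv]) (simp add: inner_axis' mem_unit_cube True)
    next
      case False
      then have "r = real (a $ t) + 1"
        using that by simp
      then show ?thesis
        by (intro face_of_Int_supporting_hyperplane_le[OF conv]) (simp add: inner_axis' mem_unit_cube)
    qed
    ultimately show ?thesis
      by simp
  qed
  {
    assume F: "F facet_of unit_cube a"
    then obtain w \<beta> where w: "w \<noteq> 0" "unit_cube a \<subseteq> {x. w \<bullet> x \<le> \<beta>}"
      "F = unit_cube a \<inter> {x. w \<bullet> x = \<beta>}"
      using facet_of_polyhedron[of "unit_cube a" F] by (auto simp: unit_cube_def)
    from w(1) obtain t where t: "w $ t \<noteq> 0"
      by (auto simp: vec_eq_iff)
    define r where "r = (if w $ t > 0 then real (a $ t) + 1 else real (a $ t))"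
    have r: "r \<in> {real (a $ t), real (a $ t) + 1}"
      by (simp add: r_def)
    let ?G = "unit_cube a \<inter> {x. x $ t = r}"
    have "F \<subseteq> ?G"
    proof
      fix z assume z: "z \<in> F"
      then have zc: "z \<in> unit_cube a" "w \<bullet> z = \<beta>"
        using w(3) by auto
      define z' where "z' = z + axis t (r - z $ t)"
      have "z' \<in> unit_cube a"
        using zc(1) r by (auto simp: mem_unit_cube z'_def axis_def)
      then have "w \<bullet> z' \<le> \<beta>"
        using w(2) by auto
      then have "w $ t * (r - z $ t) \<le> 0"
        by (simp add: z'_def inner_add_right zc(2) inner_axis)
      moreover have "w $ t > 0 \<Longrightarrow> z $ t \<le> r" "\<not> w $ t > 0 \<Longrightarrow> r \<le> z $ t"
        using zc(1) by (auto simp: r_def mem_unit_cube)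
      ultimately have "z $ t = r"
        using t by (cases "w $ t > 0") (auto simp: mult_le_0_iff)
      then show "z \<in> ?G"
        using zc(1) by simp
    qed
    have "F face_of ?G"
      by (rule face_of_subset[OF facet_of_imp_face_of[OF F] \<open>F \<subseteq> ?G\<close>]) (rule Int_lower1)
    moreover have "aff_dim F = aff_dim ?G"
      using F by (simp add: facet_of_def aff_dim_unit_cube aff_dim_unit_cube_slice[OF r])
    moreover have "convex ?G"
      using slice[OF r] by (rule face_of_imp_convex)
    ultimately have "F = ?G"
      using face_of_aff_dim_lt[of ?G F] by linarith
    then show "\<exists>t. \<exists>r \<in> {real (a $ t), real (a $ t) + 1}. F = unit_cube a \<inter> {x. x $ t = r}"
      using r by blast
  next
    assume "\<exists>t. \<exists>r \<in> {real (a $ t), real (a $ t) + 1}. F = unit_cube a \<inter> {x. x $ t = r}"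
    then obtain t r where r: "r \<in> {real (a $ t), real (a $ t) + 1}"
      and F: "F = unit_cube a \<inter> {x. x $ t = r}"
      by blast
    have "F \<noteq> {}"
    proof -
      have "(\<chi> i. if i = t then r else real (a $ i)) \<in> F"
        using r by (auto simp: F mem_unit_cube)
      then show ?thesis
        by blast
    qed
    then show "F facet_of unit_cube a"
      using slice[OF r] by (simp add: facet_of_def F aff_dim_unit_cube aff_dim_unit_cube_slice[OF r])
  }
qed

lemma normal_vector_unit_cube_facet:
  fixes a :: "nat ^ 'd"
  assumes "r \<in> {real (a $ t), real (a $ t) + 1}"
  shows "normal_vector (unit_cube a \<inter> {x. x $ t = r}) u \<longleftrightarrow> u \<noteq> 0 \<and> (\<forall>j. j \<noteq> t \<longrightarrow> u $ j = 0)"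
proof (intro iffI conjI allI impI)
  assume n: "normal_vector (unit_cube a \<inter> {x. x $ t = r}) u"
  then show "u \<noteq> 0"
    by (simp add: normal_vector_def)
  fix j assume j: "j \<noteq> t"
  \<comment> \<open>\<open>p\<close> and \<open>p + axis j 1\<close> span an edge of the facet in
    direction \<open>j\<close>, to which a normal vector must be orthogonal.\<close>
  define p where "p = (\<chi> i. if i = t then r else real (a $ i))"
  have "p + axis j 1 \<in> unit_cube a \<inter> {x. x $ t = r}" "p \<in> unit_cube a \<inter> {x. x $ t = r}"
    using assms j by (auto simp: p_def mem_unit_cube axis_def)
  then have "orthogonal u (p + axis j 1 - p)"
    using n unfolding normal_vector_def by blast
  then show "u $ j = 0"
    by (simp add: orthogonal_def inner_axis)
next
  assume u: "u \<noteq> 0 \<and> (\<forall>j. j \<noteq> t \<longrightarrow> u $ j = 0)"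
  have "u \<bullet> (p - q) = 0" if "p $ t = r" "q $ t = r" for p q
    unfolding inner_vec_def
  proof (intro sum.neutral ballI)
    fix i show "u $ i \<bullet> (p - q) $ i = 0"
      using u that by (cases "i = t") auto
  qed
  then show "normal_vector (unit_cube a \<inter> {x. x $ t = r}) u"
    using u by (auto simp: normal_vector_def orthogonal_def)
qed

text \<open>At most 45 degrees to the axis \<open>t\<close> means that the square of
  \<open>v $ t\<close> is at least half of the square of \<open>norm v\<close>, hence at least the
  sum of all other squared coordinates.\<close>

lemma facet_blocks_direction_imp_dominant:
  fixes a :: "nat ^ 'd"
  assumes r: "r \<in> {real (a $ t), real (a $ t) + 1}"
    and blocks: "facet_blocks_direction (pi / 4) (unit_cube a \<inter> {x. x $ t = r}) v"
  shows "\<bar>v $ j\<bar> \<le> \<bar>v $ t\<bar>"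
proof -
  obtain u where u: "u \<noteq> 0" "\<And>j. j \<noteq> t \<Longrightarrow> u $ j = 0" and angle: "vec_angle v u \<le> pi / 4"
    using blocks by (auto simp: facet_blocks_direction_def normal_vector_unit_cube_facet[OF r])
  have "v \<bullet> u = v $ t * u $ t"
    by (simp add: inner_vec_def sum.remove[of _ t] u(2))
  have "norm u = \<bar>u $ t\<bar>"
  proof -
    have "u = axis t (u $ t)"
      using u(2) by (simp add: vec_eq_iff axis_def)
    then have "u \<bullet> u = u $ t * u $ t"
      by (metis inner_axis inner_real_def)
    then show ?thesis
      by (simp add: norm_eq_sqrt_inner)
  qed
  define c where "c = v \<bullet> u / (norm v * norm u)"
  \<comment> \<open>This includes \<open>v = 0\<close>, where division by zero makes
    \<open>c\<close> equal to 0.\<close>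
  have c: "\<bar>c\<bar> \<le> 1"
    using Cauchy_Schwarz_ineq2[of v u] by (auto simp: c_def abs_mult divide_le_eq_1)
  have "arccos c \<le> pi / 4"
    using angle by (simp add: vec_angle_def c_def)
  then have "cos (pi / 4) \<le> cos (arccos c)"
    using c by (intro cos_monotone_0_pi_le) (auto intro: arccos_lbound)
  then have "sqrt 2 / 2 \<le> c"
    using c by (simp add: cos_45 cos_arccos_abs)
  then have "sqrt 2 / 2 * (norm v * norm u) \<le> c * (norm v * norm u)"
    by (intro mult_right_mono) auto
  also have "\<dots> = v \<bullet> u"
    by (simp add: c_def)
  also have "\<dots> \<le> \<bar>v $ t\<bar> * norm u"
    using \<open>v \<bullet> u = _\<close> \<open>norm u = _\<close> by (metis abs_ge_self abs_mult)
  finally have "sqrt 2 / 2 * norm v \<le> \<bar>v $ t\<bar>"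
    using u(1) by simp
  then have "(sqrt 2 / 2 * norm v)\<^sup>2 \<le> \<bar>v $ t\<bar>\<^sup>2"
    by (intro power_mono) auto
  then have *: "(norm v)\<^sup>2 \<le> 2 * (v $ t)\<^sup>2"
    by (simp add: power_mult_distrib power_divide)
  show ?thesis
  proof (cases "j = t")
    case False
    have "(norm v)\<^sup>2 = (\<Sum>i\<in>UNIV. (v $ i)\<^sup>2)"
      unfolding power2_norm_eq_inner by (simp add: inner_vec_def power2_eq_square)
    also have "\<dots> \<ge> (\<Sum>i\<in>{j, t}. (v $ i)\<^sup>2)"
      by (intro sum_mono2) auto
    finally have "(v $ j)\<^sup>2 \<le> (v $ t)\<^sup>2"
      using False * by simp
    then show ?thesis
      by (simp add: abs_le_square_iff)
  qed simp
qed

text \<open>The ray \<open>(b, u)\<close> passes through \<open>b + k u\<close> at height \<open>k\<close> in direction \<open>t\<close>, and \<open>e\<close> selects the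
  bottom (0) or top (1) facet of a cube. Comparing only facets of the same kind weakens the
  obstruction, which is harmless for an upper bound.\<close>

definition ray_meets :: "'d \<Rightarrow> nat \<Rightarrow> ('d \<Rightarrow> real) \<Rightarrow> ('d \<Rightarrow> real) \<Rightarrow> nat ^ 'd \<Rightarrow> bool" where
  "ray_meets t e b u a \<longleftrightarrow> (\<forall>j. j \<noteq> t \<longrightarrow>
     real (a $ j) \<le> b j + real (a $ t + e) * u j \<and> b j + real (a $ t + e) * u j \<le> real (a $ j) + 1)"

text \<open>Blockers start at height 1: the bottom facet of a cube in layer 0 may lie behind the
  starting point of the ray. The bounds on \<open>b\<close> and \<open>u\<close> are those of a ray
  that starts in the observer and has \<open>t\<close> as dominant axis.\<close>

definition seen :: "(nat ^ 'd) set \<Rightarrow> 'd \<Rightarrow> nat \<Rightarrow> (nat ^ 'd) set" where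
  "seen A t e = {a \<in> A. 1 \<le> a $ t \<and>
     (\<exists>b u. (\<forall>j. \<bar>b j\<bar> \<le> 2 \<and> \<bar>u j\<bar> \<le> 1) \<and> ray_meets t e b u a \<and>
        (\<forall>a'\<in>A. 1 \<le> a' $ t \<longrightarrow> a' $ t < a $ t \<longrightarrow> \<not> ray_meets t e b u a'))}"

text \<open>The facet that is hit fixes the dominant axis \<open>t\<close>. Above layer 0, facets
  orthogonal to \<open>t\<close> have height at least 1, so the ray, which starts at height at most
  1, climbs and can be parametrised by height. A lower cube met by it would block it, since parallel
  facets have the same normals.\<close>

lemma visible_imp_seen:
  fixes a :: "nat ^ 'd"
  assumes "visible (pi / 4) (unit_cube ` A) (unit_cube a)" and "a \<in> A"
  shows "\<exists>t. a $ t = 0 \<or> (\<exists>e\<in>{0, 1}. a \<in> seen A t e)"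
proof -
  obtain x y F where x: "x \<in> observer_cube" and F: "F facet_of unit_cube a" and y: "y \<in> F" "y \<noteq> x"
    and blocks: "facet_blocks_direction (pi / 4) F (y - x)"
    and free: "\<And>Q' F'. Q' \<in> unit_cube ` A - {unit_cube a} \<Longrightarrow> F' facet_of Q' \<Longrightarrow>
        facet_blocks_direction (pi / 4) F' (y - x) \<Longrightarrow> (closed_segment x y - {y}) \<inter> F' = {}"
    using assms(1) unfolding visible_def by metis
  obtain t r where r: "r \<in> {real (a $ t), real (a $ t) + 1}" and F: "F = unit_cube a \<inter> {x. x $ t = r}"
    using F unfolding facet_of_unit_cube by blast
  then obtain e :: nat where e: "e \<in> {0, 1}" "r = real (a $ t + e)"
    by (auto intro: that[of 0] that[of 1])
  have dom: "\<bar>y $ j - x $ j\<bar> \<le> \<bar>y $ t - x $ t\<bar>" for j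
    using facet_blocks_direction_imp_dominant[OF r blocks[unfolded F], of j] by simp
  have x01: "0 \<le> x $ j" "x $ j \<le> 1" for j
    using x by (auto simp: observer_cube_def mem_unit_cube)
  have yt: "y $ t = r"
    using y F by auto
  \<comment> \<open>Equality would, by dominance of \<open>t\<close>, force
    \<open>y = x\<close>.\<close>
  have "y $ t \<noteq> x $ t"
    using dom y(2) by (auto simp: vec_eq_iff)
  show ?thesis
  proof (cases "a $ t = 0")
    case False
    have r1: "r \<ge> 1"
      using False e by auto
    then have gt: "y $ t > x $ t"
      using x01(2)[of t] \<open>y $ t \<noteq> x $ t\<close> yt by linarith
    \<comment> \<open>\<open>u\<close> is the slope per unit of height and \<open>b\<close> the
      position extrapolated to height 0.\<close>
    define u where "u j = (y $ j - x $ j) / (y $ t - x $ t)" for j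
    define b where "b j = x $ j - x $ t * u j" for j
    have u: "\<bar>u j\<bar> \<le> 1" for j
      using dom[of j] gt by (simp add: u_def abs_mult divide_le_eq_1)
    have b: "\<bar>b j\<bar> \<le> 2" for j
    proof -
      have "\<bar>x $ t * u j\<bar> \<le> 1 * 1"
        unfolding abs_mult using u x01 by (intro mult_mono) auto
      then show ?thesis
        using x01[of j] by (simp add: b_def)
    qed
    have line: "b j + s * u j = x $ j + (s - x $ t) / (y $ t - x $ t) * (y $ j - x $ j)" for j s
      by (simp add: b_def u_def diff_divide_distrib algebra_simps)
    have yeq: "b j + r * u j = y $ j" for j
      unfolding line using gt yt by simp
    have "ray_meets t e b u a"
      using y(1) unfolding ray_meets_def e(2)[symmetric] yeq F by (auto simp: mem_unit_cube)
    moreover have "\<not> ray_meets t e b u a'" if "a' \<in> A" "1 \<le> a' $ t" "a' $ t < a $ t" for a'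
    proof
      assume m: "ray_meets t e b u a'"
      define r' where "r' = real (a' $ t + e)"
      have r': "r' \<in> {real (a' $ t), real (a' $ t) + 1}" "r' \<ge> 1" "r' < r"
        using e that by (auto simp: r'_def)
      let ?F = "unit_cube a' \<inter> {x. x $ t = r'}"
      \<comment> \<open>The parameter at which the segment reaches height \<open>r'\<close>;
        \<open>s < 1\<close> keeps the meeting point away from \<open>y\<close>, the only point
        exempt from blocking.\<close>
      define s where "s = (r' - x $ t) / (y $ t - x $ t)"
      have s: "0 \<le> s" "s < 1"
        using r'(2,3) x01(2)[of t] gt yt by (auto simp: s_def divide_less_eq)
      define p where "p = x + s *\<^sub>R (y - x)"
      have pj: "p $ j = b j + r' * u j" for j
        unfolding line by (simp add: p_def s_def)
      have "p $ t = r'"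
        unfolding p_def s_def using gt by simp
      moreover have "p \<in> unit_cube a'"
        unfolding mem_unit_cube
      proof
        fix i
        show "real (a' $ i) \<le> p $ i \<and> p $ i \<le> real (a' $ i) + 1"
        proof (cases "i = t")
          case True
          then show ?thesis
            using \<open>p $ t = r'\<close> r' by auto
        next
          case False
          then show ?thesis
            using m unfolding ray_meets_def r'_def[symmetric] pj by auto
        qed
      qed
      ultimately have "p \<in> ?F"
        by simp
      moreover have "p \<in> closed_segment x y"
        unfolding in_segment p_def using s by (intro exI[of _ s]) (auto simp: algebra_simps)
      moreover have "p \<noteq> y"
        using \<open>p $ t = r'\<close> r'(3) yt by auto
      moreover have "?F facet_of unit_cube a'"
        using r'(1) unfolding facet_of_unit_cube by blast
      moreover have "facet_blocks_direction (pi / 4) ?F (y - x)"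
        using blocks unfolding facet_blocks_direction_def F normal_vector_unit_cube_facet[OF r]
          normal_vector_unit_cube_facet[OF r'(1)] .
      moreover have "unit_cube a' \<in> unit_cube ` A - {unit_cube a}"
        using that by auto
      ultimately show False
        using free by blast
    qed
    ultimately have "a \<in> seen A t e"
      unfolding seen_def mem_Collect_eq using assms(2) False u b
      by (metis One_nat_def Suc_leI neq0_conv)
    then show ?thesis
      using e by blast
  qed blast
qed

section \<open>Resonant slopes\<close>

text \<open>\<open>g\<close> is resonant at scale \<open>m\<close> if some lattice vector with height \<open>q \<le> n / m\<close> deviates from the
  direction \<open>g / n\<close> by at most \<open>1 / m\<close> in every coordinate.\<close>

definition resonant :: "'d \<Rightarrow> nat \<Rightarrow> ('d \<Rightarrow> int) \<Rightarrow> nat \<Rightarrow> bool" where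
  "resonant t n g m \<longleftrightarrow> (\<exists>q::nat. 1 \<le> q \<and> q * m \<le> n \<and>
     (\<forall>j. j \<noteq> t \<longrightarrow> (\<exists>c. int m * \<bar>int q * g j - c * int n\<bar> \<le> int n)))"

text \<open>Slopes in \<open>[-1, 1]\<close> are scaled by \<open>n\<close> and rounded down or up;
  rounding up is the floor plus 1, hence the upper end \<open>n + 1\<close>.\<close>

definition bucket_grid :: "'d::finite \<Rightarrow> nat \<Rightarrow> ('d \<Rightarrow> int) set" where
  "bucket_grid t n = (UNIV - {t}) \<rightarrow>\<^sub>E {- int n..int n + 1}"

section \<open>Counting resonant slopes\<close>

lemma card_ints_near_le:
  assumes "w \<ge> 0"
  shows "finite {x::int. \<bar>real_of_int x - r\<bar> \<le> w}"
    and "real (card {x::int. \<bar>real_of_int x - r\<bar> \<le> w}) \<le> 2 * w + 1"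
proof -
  have *: "{x::int. \<bar>real_of_int x - r\<bar> \<le> w} = {\<lceil>r - w\<rceil>..\<lfloor>r + w\<rfloor>}"
    by (auto simp: abs_le_iff le_floor_iff ceiling_le_iff)
  show "finite {x::int. \<bar>real_of_int x - r\<bar> \<le> w}"
    unfolding * by simp
  have "real_of_int \<lfloor>r + w\<rfloor> - real_of_int \<lceil>r - w\<rceil> \<le> 2 * w"
    by linarith
  then show "real (card {x::int. \<bar>real_of_int x - r\<bar> \<le> w}) \<le> 2 * w + 1"
    unfolding * using assms by simp
qed

text \<open>Each such \<open>x\<close> is within \<open>n / (m * q)\<close> of a multiple of
  \<open>n / q\<close>, and only O(q) multiples are in reach. Since \<open>q * m \<le> n\<close>,
  this distance is at least 1, so each multiple accounts for O(n / (m q)) integers and the factor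
  \<open>q\<close> cancels.\<close>

lemma card_near_multiples_le:
  fixes n m q :: nat
  assumes "1 \<le> m" "1 \<le> q" "q * m \<le> n"
  shows "real (card {x \<in> {- int n..int n + 1}. \<exists>c. int m * \<bar>int q * x - c * int n\<bar> \<le> int n})
    \<le> 21 * real n / real m"
proof -
  let ?w = "real n / (real m * real q)"
  let ?Y = "\<lambda>c::int. {x::int. \<bar>real_of_int x - real_of_int c * real n / real q\<bar> \<le> ?w}"
  have n: "n \<ge> 1"
    using assms by (metis le_trans mult_le_mono nat_mult_1)
  have w: "?w \<ge> 1"
    using assms by (simp add: le_divide_eq mult.commute flip: of_nat_mult)
  have "{x \<in> {- int n..int n + 1}. \<exists>c. int m * \<bar>int q * x - c * int n\<bar> \<le> int n}
    \<subseteq> (\<Union>c\<in>{- (2 * int q + 1)..2 * int q + 1}. ?Y c)"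
  proof
    fix x assume "x \<in> {x \<in> {- int n..int n + 1}. \<exists>c. int m * \<bar>int q * x - c * int n\<bar> \<le> int n}"
    then obtain c where x: "- int n \<le> x" "x \<le> int n + 1"
      and c: "int m * \<bar>int q * x - c * int n\<bar> \<le> int n"
      by auto
    have "1 * \<bar>int q * x - c * int n\<bar> \<le> int m * \<bar>int q * x - c * int n\<bar>"
      using assms by (intro mult_right_mono) auto
    also note c
    finally have "\<bar>int q * x - c * int n\<bar> \<le> int n"
      by simp
    moreover have "\<bar>int q * x\<bar> \<le> int q * (2 * int n)"
      unfolding abs_mult using x n by (intro mult_mono) auto
    ultimately have "\<bar>c * int n\<bar> \<le> (2 * int q + 1) * int n"
      by (simp add: algebra_simps)
    then have "\<bar>c\<bar> \<le> 2 * int q + 1"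
      using n by (simp add: abs_mult)
    moreover have "x \<in> ?Y c"
    proof -
      have "real m * \<bar>real q * x - c * real n\<bar> \<le> real n"
        using c by (metis (mono_tags, opaque_lifting) of_int_abs of_int_diff of_int_le_iff of_int_mult of_int_of_nat_eq)
      moreover have "real m * \<bar>real q * x - c * real n\<bar>
          = \<bar>real_of_int x - real_of_int c * real n / real q\<bar> * (real m * real q)"
      proof -
        have "real q * x - c * real n = (real_of_int x - real_of_int c * real n / real q) * real q"
          using assms by (simp add: field_simps)
        then show ?thesis
          by (simp only: abs_mult) simp
      qed
      ultimately show ?thesis
        using assms by (simp add: le_divide_eq)
    qed
    ultimately show "x \<in> (\<Union>c\<in>{- (2 * int q + 1)..2 * int q + 1}. ?Y c)"
      by (intro UN_I[of c]) auto
  qed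
  moreover have fin: "finite (?Y c)" for c
    by (intro card_ints_near_le) simp
  ultimately have "card {x \<in> {- int n..int n + 1}. \<exists>c. int m * \<bar>int q * x - c * int n\<bar> \<le> int n}
    \<le> card (\<Union>c\<in>{- (2 * int q + 1)..2 * int q + 1}. ?Y c)"
    by (intro card_mono) auto
  also have "\<dots> \<le> (\<Sum>c\<in>{- (2 * int q + 1)..2 * int q + 1}. card (?Y c))"
    by (intro card_UN_le) simp
  finally have "real (card {x \<in> {- int n..int n + 1}. \<exists>c. int m * \<bar>int q * x - c * int n\<bar> \<le> int n})
    \<le> real (\<Sum>c\<in>{- (2 * int q + 1)..2 * int q + 1}. card (?Y c))"
    by (simp only: of_nat_le_iff)
  also have "\<dots> \<le> (\<Sum>c\<in>{- (2 * int q + 1)..2 * int q + 1}. 3 * ?w)"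
    unfolding of_nat_sum
  proof (intro sum_mono)
    fix c
    have "real (card (?Y c)) \<le> 2 * ?w + 1"
      by (intro card_ints_near_le) simp
    then show "real (card (?Y c)) \<le> 3 * ?w"
      using w by linarith
  qed
  \<comment> \<open>There are \<open>4 * q + 3\<close> values of \<open>c\<close>, at most
    \<open>7 * q\<close> because \<open>1 \<le> q\<close>.\<close>
  also have "\<dots> = (4 * real q + 3) * (3 * ?w)"
    by simp
  also have "\<dots> \<le> (7 * real q) * (3 * ?w)"
    using assms by (intro mult_right_mono) auto
  also have "\<dots> = 21 * real n / real m"
    using assms by simp
  finally show ?thesis .
qed

lemma card_bucket_grid: "card (bucket_grid (t::'d::finite) n) = (2 * n + 2) ^ (CARD('d) - 1)"
proof -
  have "card {- int n..int n + 1} = 2 * n + 2"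
    by simp
  then show ?thesis
    unfolding bucket_grid_def by (subst card_PiE) (simp_all only: prod_constant card_Diff_singleton_if finite_class.finite_UNIV UNIV_I if_True finite_Diff finite)
qed

lemma finite_bucket_grid: "finite (bucket_grid t n)"
  by (simp add: bucket_grid_def finite_PiE)

text \<open>For a fixed height \<open>q\<close> the conditions on the coordinates of
  \<open>g\<close> are independent, so the counts multiply; there are at most \<open>n / m\<close>
  heights.\<close>

lemma card_resonant_le:
  fixes t :: "'d::finite"
  assumes m: "1 \<le> m"
  shows "real (card {g \<in> bucket_grid t n. resonant t n g m})
    \<le> real n / real m * (21 * real n / real m) ^ (CARD('d) - 1)"
proof -
  let ?X = "\<lambda>q. {x \<in> {- int n..int n + 1}. \<exists>c. int m * \<bar>int q * x - c * int n\<bar> \<le> int n}"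
  let ?P = "\<lambda>q. (UNIV - {t}) \<rightarrow>\<^sub>E ?X q"
  have "{g \<in> bucket_grid t n. resonant t n g m} \<subseteq> (\<Union>q\<in>{1..n div m}. ?P q)"
  proof
    fix g assume g: "g \<in> {g \<in> bucket_grid t n. resonant t n g m}"
    then obtain q where q: "1 \<le> q" "q * m \<le> n"
      "\<And>j. j \<noteq> t \<Longrightarrow> \<exists>c. int m * \<bar>int q * g j - c * int n\<bar> \<le> int n"
      by (auto simp: resonant_def)
    have "q \<in> {1..n div m}"
      using q(1,2) m by (simp add: less_eq_div_iff_mult_less_eq)
    moreover have "g \<in> ?P q"
      using g q(3) by (auto simp: bucket_grid_def PiE_iff)
    ultimately show "g \<in> (\<Union>q\<in>{1..n div m}. ?P q)"
      by blast
  qed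
  then have "card {g \<in> bucket_grid t n. resonant t n g m} \<le> card (\<Union>q\<in>{1..n div m}. ?P q)"
  proof (rule card_mono[rotated])
    show "finite (\<Union>q\<in>{1..n div m}. ?P q)"
      by (intro finite_UN_I finite_PiE finite_Collect_conjI disjI1) auto
  qed
  also have "\<dots> \<le> (\<Sum>q\<in>{1..n div m}. card (?P q))"
    by (intro card_UN_le) simp
  finally have "real (card {g \<in> bucket_grid t n. resonant t n g m}) \<le> real (\<Sum>q\<in>{1..n div m}. card (?P q))"
    by (simp only: of_nat_le_iff)
  also have "\<dots> = (\<Sum>q\<in>{1..n div m}. real (card (?X q)) ^ (CARD('d) - 1))"
    by (simp add: card_PiE)
  also have "\<dots> \<le> (\<Sum>q\<in>{1..n div m}. (21 * real n / real m) ^ (CARD('d) - 1))"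
  proof (intro sum_mono power_mono card_near_multiples_le m)
    fix q assume q: "q \<in> {1..n div m}"
    then show "1 \<le> q" "q * m \<le> n"
      using m by (auto simp: less_eq_div_iff_mult_less_eq)
  qed auto
  also have "\<dots> = real (n div m) * (21 * real n / real m) ^ (CARD('d) - 1)"
    by simp
  also have "\<dots> \<le> real n / real m * (21 * real n / real m) ^ (CARD('d) - 1)"
    by (intro mult_right_mono of_nat_div_le_of_nat) auto
  finally show ?thesis .
qed

section \<open>The least non-resonant scale and its power sums\<close>

definition resolution :: "'d \<Rightarrow> nat \<Rightarrow> ('d \<Rightarrow> int) \<Rightarrow> nat" where
  "resolution t n g = (LEAST m. 1 \<le> m \<and> \<not> resonant t n g m)"

text \<open>The resolution is the scale at which a bucket gets subdivided: non-resonance there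
  separates its cubes, while resonance at all smaller scales makes a large resolution rare. The
  least scale exists because at \<open>n + 1\<close> no height \<open>q \<ge> 1\<close> satisfies
  \<open>q * (n + 1) \<le> n\<close>.\<close>

lemma resolution:
  shows "1 \<le> resolution t n g" and "\<not> resonant t n g (resolution t n g)"
    and "resolution t n g \<le> n + 1"
    and "1 \<le> m \<Longrightarrow> m < resolution t n g \<Longrightarrow> resonant t n g m"
proof -
  have *: "1 \<le> n + 1 \<and> \<not> resonant t n g (n + 1)"
  proof -
    have "\<not> q * (n + 1) \<le> n" if "1 \<le> q" for q
    proof -
      have "1 * (n + 1) \<le> q * (n + 1)"
        using that by (rule mult_le_mono1)
      then show ?thesis by simp
    qed
    then show ?thesis
      by (auto simp: resonant_def)
  qed
  show "1 \<le> resolution t n g" "\<not> resonant t n g (resolution t n g)"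
    using LeastI[of "\<lambda>m. 1 \<le> m \<and> \<not> resonant t n g m", OF *] by (auto simp: resolution_def)
  show "resolution t n g \<le> n + 1"
    unfolding resolution_def using * by (rule Least_le)
  show "1 \<le> m \<Longrightarrow> m < resolution t n g \<Longrightarrow> resonant t n g m"
    using not_less_Least[of m "\<lambda>m. 1 \<le> m \<and> \<not> resonant t n g m"] by (auto simp: resolution_def)
qed

text \<open>This is the binomial bound, with \<open>2 ^ D - 1\<close> the sum of all coefficients
  but the leading one; the factor \<open>m\<close> on the left avoids the exponent
  \<open>D - 1\<close>. The induction rests on \<open>m + 1 \<le> 2 * m\<close>.\<close>

lemma power_Suc_diff_le:
  assumes "1 \<le> m"
  shows "real m * (real (m + 1) ^ D - real m ^ D) \<le> (2 ^ D - 1) * real m ^ D"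
proof (induction D)
  case (Suc D)
  have "real m * (real (m + 1) ^ Suc D - real m ^ Suc D)
    = real (m + 1) * (real m * (real (m + 1) ^ D - real m ^ D)) + real m * real m ^ D"
    by (simp add: algebra_simps)
  also have "\<dots> \<le> real (m + 1) * ((2 ^ D - 1) * real m ^ D) + real m * real m ^ D"
    using Suc by (intro add_right_mono mult_left_mono) auto
  also have "\<dots> \<le> (2 * real m) * ((2 ^ D - 1) * real m ^ D) + real m * real m ^ D"
    using assms by (intro add_right_mono mult_right_mono) auto
  also have "\<dots> = (2 ^ Suc D - 1) * real m ^ Suc D"
    by (simp add: algebra_simps)
  finally show ?case .
qed simp

text \<open>Telescoping with \<open>1 / x ^ 2 \<le> 2 / x - 2 / (x + 1)\<close> for
  \<open>x \<ge> 1\<close>.\<close>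

lemma sum_inverse_squares_le:
  assumes "1 \<le> k"
  shows "(\<Sum>m = k..n. 1 / (real m)\<^sup>2) \<le> 2 / real k"
proof -
  have *: "(\<Sum>m\<in>{k..<k + i}. 1 / (real m)\<^sup>2) \<le> 2 / real k - 2 / real (k + i)" for i
  proof (induction i)
    case (Suc i)
    have pos: "real (k + i) \<ge> 1"
      using assms by simp
    have "1 / x\<^sup>2 \<le> 2 / x - 2 / (x + 1)" if "1 \<le> x" for x :: real
    proof -
      have "1 / x\<^sup>2 = 2 / (x * (2 * x))"
        by (simp add: power2_eq_square)
      also have "\<dots> \<le> 2 / (x * (x + 1))"
        using that by (intro divide_left_mono mult_left_mono mult_pos_pos) auto
      also have "\<dots> = 2 / x - 2 / (x + 1)"
        using that by (simp add: field_simps)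
      finally show ?thesis .
    qed
    from this[OF pos] show ?case
      using Suc by (simp add: add_ac)
  qed simp
  show ?thesis
  proof (cases "k \<le> n")
    case True
    then have "{k..n} = {k..<k + (n + 1 - k)}"
      by auto
    then have "(\<Sum>m = k..n. 1 / (real m)\<^sup>2) \<le> 2 / real k - 2 / real (k + (n + 1 - k))"
      using *[of "n + 1 - k"] by simp
    also have "\<dots> \<le> 2 / real k"
      by simp
    finally show ?thesis .
  qed simp
qed

text \<open>The power telescopes from \<open>k\<close> up to the resolution, and every scale passed
  is resonant. Written with indicators, the bound can be summed over \<open>g\<close> by counting
  resonant slopes scale by scale.\<close>

lemma power_resolution_le:
  assumes "1 \<le> k"
  shows "real (resolution t n g) ^ D
    \<le> real k ^ D + (\<Sum>m = k..n. if resonant t n g m then real (m + 1) ^ D - real m ^ D else 0)"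
proof (cases "k \<le> resolution t n g")
  case True
  let ?M = "resolution t n g"
  have "real ?M ^ D - real k ^ D = (\<Sum>m = k..<?M. real (Suc m) ^ D - real m ^ D)"
    using sum_Suc_diff'[OF True, of "\<lambda>m. real m ^ D"] by simp
  also have "\<dots> = (\<Sum>m = k..<?M. if resonant t n g m then real (m + 1) ^ D - real m ^ D else 0)"
  proof (intro sum.cong refl)
    fix m assume "m \<in> {k..<?M}"
    then have "resonant t n g m"
      using assms resolution(4)[of m t n g] by auto
    then show "real (Suc m) ^ D - real m ^ D = (if resonant t n g m then real (m + 1) ^ D - real m ^ D else 0)"
      by simp
  qed
  also have "\<dots> \<le> (\<Sum>m = k..n. if resonant t n g m then real (m + 1) ^ D - real m ^ D else 0)"
    using resolution(3)[of t n g] by (intro sum_mono2) (auto intro!: power_mono)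
  finally show ?thesis
    by simp
next
  case False
  then have "real (resolution t n g) ^ D \<le> real k ^ D"
    by (intro power_mono) auto
  also have "\<dots> \<le> real k ^ D + (\<Sum>m = k..n. if resonant t n g m then real (m + 1) ^ D - real m ^ D else 0)"
    by (simp, intro sum_nonneg) (auto intro!: power_mono)
  finally show ?thesis .
qed

text \<open>After exchanging the sums, scale \<open>m\<close> contributes O((n / m) ^ (D + 1))
  resonant slopes times an increment O(m ^ (D - 1)), that is O(n ^ (D + 1) / m ^ 2), and the sum of
  these from \<open>k\<close> on is O(n ^ (D + 1) / k).\<close>

lemma sum_power_resolution_le:
  fixes t :: "'d::finite"
  assumes k: "1 \<le> k"
  defines "D \<equiv> CARD('d) - 1"
  shows "(\<Sum>g\<in>bucket_grid t n. real (resolution t n g) ^ D)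
    \<le> (2 * real n + 2) ^ D * real k ^ D + 42 ^ D * (2 * real n ^ Suc D / real k)"
proof -
  let ?w = "\<lambda>m. real (m + 1) ^ D - real m ^ D"
  have "(\<Sum>g\<in>bucket_grid t n. real (resolution t n g) ^ D)
    \<le> (\<Sum>g\<in>bucket_grid t n. real k ^ D + (\<Sum>m = k..n. if resonant t n g m then ?w m else 0))"
    by (intro sum_mono power_resolution_le k)
  also have "\<dots> = (2 * real n + 2) ^ D * real k ^ D
      + (\<Sum>m = k..n. \<Sum>g\<in>bucket_grid t n. if resonant t n g m then ?w m else 0)"
    unfolding sum.distrib by (subst (2) sum.swap) (simp add: card_bucket_grid D_def add.commute)
  also have "(\<Sum>m = k..n. \<Sum>g\<in>bucket_grid t n. if resonant t n g m then ?w m else 0)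
    \<le> (\<Sum>m = k..n. 42 ^ D * real n ^ Suc D * (1 / (real m)\<^sup>2))"
  proof (intro sum_mono)
    fix m assume "m \<in> {k..n}"
    then have m: "1 \<le> m"
      using k by simp
    have "(\<Sum>g\<in>bucket_grid t n. if resonant t n g m then ?w m else 0)
      = real (card {g \<in> bucket_grid t n. resonant t n g m}) * ?w m"
      by (simp add: sum.If_cases[OF finite_bucket_grid] Int_def)
    also have "\<dots> \<le> (real n / real m * (21 * real n / real m) ^ D) * ?w m"
      using card_resonant_le[OF m, of t n] by (intro mult_right_mono) (auto simp: D_def intro!: power_mono)
    also have "\<dots> = (real n / real m * (21 * real n / real m) ^ D) / real m * (real m * ?w m)"
      using m by simp
    also have "\<dots> \<le> (real n / real m * (21 * real n / real m) ^ D) / real m * (2 ^ D * real m ^ D)"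
    proof (intro mult_left_mono)
      have "real m * ?w m \<le> (2 ^ D - 1) * real m ^ D"
        by (rule power_Suc_diff_le[OF m])
      also have "\<dots> \<le> 2 ^ D * real m ^ D"
        by (intro mult_right_mono) auto
      finally show "real m * ?w m \<le> 2 ^ D * real m ^ D" .
    qed auto
    also have "\<dots> = (21 * 2) ^ D * real n ^ Suc D * (1 / (real m)\<^sup>2)"
      unfolding power_mult_distrib using m by (simp add: power_divide power_mult_distrib power2_eq_square)
    finally show "(\<Sum>g\<in>bucket_grid t n. if resonant t n g m then ?w m else 0)
      \<le> 42 ^ D * real n ^ Suc D * (1 / (real m)\<^sup>2)"
      by simp
  qed
  also have "\<dots> \<le> 42 ^ D * real n ^ Suc D * (2 / real k)"
    unfolding sum_distrib_left[symmetric] by (intro mult_left_mono sum_inverse_squares_le k) simp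
  finally show ?thesis
    by (simp add: mult_ac)
qed

text \<open>The terms \<open>n ^ D * k ^ D\<close> and \<open>n ^ (D + 1) / k\<close> balance when
  \<open>k ^ (D + 1) = n\<close>, that is, when \<open>k\<close> is the d-th root of
  \<open>n\<close> with \<open>d = D + 1\<close>.\<close>

lemma sum_power_resolution_powr_le:
  fixes t :: "'d::finite"
  assumes n: "1 \<le> n"
  shows "(\<Sum>g\<in>bucket_grid t n. real (resolution t n g) ^ (CARD('d) - 1))
    \<le> 3 * 42 ^ (CARD('d) - 1) * real n powr (real CARD('d) - 1 / real CARD('d))"
proof -
  define D where "D = CARD('d) - 1"
  have d: "CARD('d) = Suc D"
    by (simp add: D_def)
  define N where "N = real n powr (1 / real (Suc D))"
  \<comment> \<open>Rounding \<open>N \<ge> 1\<close> up at most doubles it.\<close>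
  define k where "k = nat \<lceil>N\<rceil>"
  have N: "1 \<le> N"
    using n by (simp add: N_def ge_one_powr_ge_zero)
  have k: "1 \<le> k" "N \<le> real k" "real k \<le> 2 * N"
    using N by (auto simp: k_def) linarith+
  have rn: "real n > 0"
    using n by simp
  have e1: "real n ^ Suc D / N = real n powr (real (Suc D) - 1 / real (Suc D))"
    unfolding N_def powr_diff using rn by (simp add: powr_realpow del: power_Suc of_nat_Suc)
  have e2: "real n ^ D * N ^ D = real n ^ Suc D / N"
  proof -
    have "N ^ Suc D = real n"
      using rn N unfolding N_def by (simp add: powr_power del: power_Suc of_nat_Suc)
    then show ?thesis
      using N by (simp add: field_simps)
  qed
  have "(2 * real n + 2) ^ D * real k ^ D \<le> (4 * real n) ^ D * (2 * N) ^ D"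
    using n k by (intro mult_mono power_mono) auto
  also have "\<dots> = (4 * 2) ^ D * (real n ^ D * N ^ D)"
    unfolding power_mult_distrib by simp
  also have "\<dots> \<le> 42 ^ D * (real n ^ D * N ^ D)"
    using N by (intro mult_right_mono power_mono) auto
  finally have 1: "(2 * real n + 2) ^ D * real k ^ D \<le> 42 ^ D * (real n ^ Suc D / N)"
    unfolding e2 .
  have 2: "42 ^ D * (2 * real n ^ Suc D / real k) \<le> 42 ^ D * (2 * real n ^ Suc D / N)"
    using k N by (intro mult_left_mono divide_left_mono) auto
  have "(\<Sum>g\<in>bucket_grid t n. real (resolution t n g) ^ D)
    \<le> (2 * real n + 2) ^ D * real k ^ D + 42 ^ D * (2 * real n ^ Suc D / real k)"
    unfolding D_def by (rule sum_power_resolution_le[OF k(1)])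
  also have "\<dots> \<le> 42 ^ D * (real n ^ Suc D / N) + 42 ^ D * (2 * real n ^ Suc D / N)"
    using 1 2 by (rule add_mono)
  also have "\<dots> = 3 * 42 ^ D * (real n ^ Suc D / N)"
    by simp
  finally show ?thesis
    unfolding e1 d by simp
qed

section \<open>Antichains of visible cubes\<close>

text \<open>The slope bucket is represented by its upper corner in the coordinates where the ray meets the
  facet in the lower half (\<open>s j\<close>), and by its lower corner otherwise. Thus, going down along the ray,
  its position relative to the direction \<open>g / n\<close> can only move towards the middle of the facet.\<close>

definition exposed_ray ::
    "'d \<Rightarrow> nat \<Rightarrow> nat \<Rightarrow> ('d \<Rightarrow> int) \<Rightarrow> ('d \<Rightarrow> bool) \<Rightarrow> ('d \<Rightarrow> real) \<Rightarrow> ('d \<Rightarrow> real) \<Rightarrow> nat ^ 'd \<Rightarrow> bool" where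
  "exposed_ray t e n g s b u a \<longleftrightarrow> (\<forall>j. j \<noteq> t \<longrightarrow> \<bar>b j\<bar> \<le> 2 \<and>
     (if s j
      then real_of_int (g j) - 1 \<le> real n * u j \<and> real n * u j \<le> real_of_int (g j) \<and>
        0 \<le> b j + real (a $ t + e) * u j - real (a $ j) \<and>
        b j + real (a $ t + e) * u j - real (a $ j) \<le> 1 / 2
      else real_of_int (g j) \<le> real n * u j \<and> real n * u j \<le> real_of_int (g j) + 1 \<and>
        1 / 2 \<le> b j + real (a $ t + e) * u j - real (a $ j) \<and>
        b j + real (a $ t + e) * u j - real (a $ j) \<le> 1))"

definition exposed ::
    "(nat ^ 'd) set \<Rightarrow> 'd \<Rightarrow> nat \<Rightarrow> nat \<Rightarrow> ('d \<Rightarrow> int) \<Rightarrow> ('d \<Rightarrow> bool) \<Rightarrow> (nat ^ 'd) set" where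
  "exposed A t e n g s = {a \<in> A. 1 \<le> a $ t \<and> (\<exists>b u. exposed_ray t e n g s b u a \<and>
     (\<forall>a'\<in>A. 1 \<le> a' $ t \<longrightarrow> a' $ t < a $ t \<longrightarrow> \<not> ray_meets t e b u a'))}"

text \<open>Transversally to \<open>t\<close>, this is \<open>n\<close> times the offset of the cube from the line through the origin
  with slopes \<open>g / n\<close>.\<close>

definition drift :: "'d \<Rightarrow> nat \<Rightarrow> nat \<Rightarrow> ('d \<Rightarrow> int) \<Rightarrow> nat ^ 'd \<Rightarrow> 'd \<Rightarrow> int" where
  "drift t e n g a j =
     (if j = t then int (a $ t) else int n * int (a $ j) - int (a $ t + e) * g j)"

lemma real_drift:
  "j \<noteq> t \<Longrightarrow> real_of_int (drift t e n g a j) = real n * real (a $ j) - real (a $ t + e) * real_of_int (g j)"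
  by (simp add: drift_def)

text \<open>The halves \<open>s\<close> are read off from the point where the ray meets the facet,
  and \<open>g\<close> rounds the scaled slopes up or down accordingly.\<close>

lemma seen_subset_exposed:
  fixes A :: "(nat ^ 'd) set"
  shows "seen A t e \<subseteq> (\<Union>g\<in>bucket_grid t n. \<Union>s\<in>{s. s t}. exposed A t e n g s)"
proof
  fix a assume "a \<in> seen A t e"
  then obtain b u where a: "a \<in> A" "1 \<le> a $ t" and bu: "\<And>j. \<bar>b j\<bar> \<le> 2" "\<And>j. \<bar>u j\<bar> \<le> 1"
    and m: "ray_meets t e b u a"
    and free: "\<forall>a'\<in>A. 1 \<le> a' $ t \<longrightarrow> a' $ t < a $ t \<longrightarrow> \<not> ray_meets t e b u a'"
    unfolding seen_def by blast
  define off where "off j = b j + real (a $ t + e) * u j - real (a $ j)" for j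
  \<comment> \<open>In direction \<open>t\<close> the value of \<open>s\<close> is a convention:
    true makes the later comparison of cubes ask for the blocker to be lower.\<close>
  define s where "s j \<longleftrightarrow> j = t \<or> off j \<le> 1 / 2" for j
  define g where "g = (\<lambda>j\<in>UNIV - {t}. \<lfloor>real n * u j\<rfloor> + (if s j then 1 else 0))"
  have off: "0 \<le> off j" "off j \<le> 1" if "j \<noteq> t" for j
    using m that by (auto simp: ray_meets_def off_def)
  have "- int n \<le> \<lfloor>real n * u j\<rfloor>" "\<lfloor>real n * u j\<rfloor> \<le> int n" for j
  proof -
    have "\<bar>real n * u j\<bar> \<le> real n * 1"
      unfolding abs_mult using bu(2)[of j] by (intro mult_mono) auto
    then have "real_of_int (- int n) \<le> real n * u j" "real n * u j \<le> real_of_int (int n)"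
      by (simp_all add: abs_le_iff)
    then show "- int n \<le> \<lfloor>real n * u j\<rfloor>" "\<lfloor>real n * u j\<rfloor> \<le> int n"
      by (simp_all only: le_floor_iff) linarith
  qed
  then have "\<lfloor>real n * u j\<rfloor> + (if s j then 1 else 0) \<in> {- int n..int n + 1}" for j
    by (smt (verit) atLeastAtMost_iff)
  then have "g \<in> bucket_grid t n"
    unfolding bucket_grid_def g_def by (simp only: restrict_PiE_iff) blast
  moreover have "s t"
    by (simp add: s_def)
  moreover have "a \<in> exposed A t e n g s"
    unfolding exposed_def exposed_ray_def mem_Collect_eq
  proof (rule conjI[OF a(1) conjI[OF a(2)]], rule exI[of _ b], rule exI[of _ u], intro conjI allI impI free bu)
    fix j assume j: "j \<noteq> t"
    show "if s j
      then real_of_int (g j) - 1 \<le> real n * u j \<and> real n * u j \<le> real_of_int (g j) \<and>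
        0 \<le> b j + real (a $ t + e) * u j - real (a $ j) \<and>
        b j + real (a $ t + e) * u j - real (a $ j) \<le> 1 / 2
      else real_of_int (g j) \<le> real n * u j \<and> real n * u j \<le> real_of_int (g j) + 1 \<and>
        1 / 2 \<le> b j + real (a $ t + e) * u j - real (a $ j) \<and>
        b j + real (a $ t + e) * u j - real (a $ j) \<le> 1"
    proof (cases "s j")
      case True
      moreover have "g j = \<lfloor>real n * u j\<rfloor> + 1"
        using j True by (simp add: g_def)
      then have "real_of_int (g j) - 1 \<le> real n * u j" "real n * u j \<le> real_of_int (g j)"
        by linarith+
      moreover have "0 \<le> off j" "off j \<le> 1 / 2"
        using True off j by (auto simp: s_def)
      ultimately show ?thesis
        by (simp add: off_def)
    next
      case False
      moreover have "g j = \<lfloor>real n * u j\<rfloor>"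
        using j False by (simp add: g_def)
      then have "real_of_int (g j) \<le> real n * u j" "real n * u j \<le> real_of_int (g j) + 1"
        by linarith+
      moreover have "1 / 2 \<le> off j" "off j \<le> 1"
        using False off j by (auto simp: s_def)
      ultimately show ?thesis
        by (simp add: off_def)
    qed
  qed
  ultimately show "a \<in> (\<Union>g\<in>bucket_grid t n. \<Union>s\<in>{s. s t}. exposed A t e n g s)"
    by blast
qed

text \<open>A transversal drift is \<open>n * b j\<close>, minus \<open>n\<close> times the offset
  on the facet, plus the height times the rounding error of the slope; these are at most
  \<open>2 * n\<close>, \<open>n\<close> and \<open>n\<close> in absolute value.\<close>

lemma abs_drift_le:
  assumes a: "a \<in> exposed A t e n g s" and n: "a $ t + e \<le> n"
  shows "\<bar>drift t e n g a j\<bar> \<le> 4 * int n"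
proof (cases "j = t")
  case False
  obtain b u where bu: "exposed_ray t e n g s b u a"
    using a unfolding exposed_def by blast
  define off where "off = b j + real (a $ t + e) * u j - real (a $ j)"
  define dev where "dev = real n * u j - real_of_int (g j)"
  have h: "\<bar>b j\<bar> \<le> 2" "\<bar>off\<bar> \<le> 1" "\<bar>dev\<bar> \<le> 1"
    using bu[unfolded exposed_ray_def, rule_format, OF False] by (auto simp: off_def dev_def split: if_splits)
  have "real_of_int (drift t e n g a j) = real n * b j - real n * off + real (a $ t + e) * dev"
    unfolding real_drift[OF False] off_def dev_def by (simp add: algebra_simps)
  also have "\<bar>\<dots>\<bar> \<le> \<bar>real n * b j\<bar> + \<bar>real n * off\<bar> + \<bar>real (a $ t + e) * dev\<bar>"
    by linarith
  also have "\<dots> \<le> real n * 2 + real n * 1 + real n * 1"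
    unfolding abs_mult using h n by (intro add_mono mult_mono) (auto simp del: of_nat_add)
  finally have "\<bar>real_of_int (drift t e n g a j)\<bar> \<le> 4 * real n"
    by simp
  then show ?thesis
    by linarith
qed (use n in \<open>simp add: drift_def\<close>)

text \<open>Following the ray of \<open>a\<close> down to the height of \<open>a'\<close>, its
  scaled offset on the facet changes by the drift difference and by the rounding error accumulated
  over the height difference \<open>K\<close>. Both push the offset from its half towards the other
  one, each by at most \<open>n / 8\<close>, so the ray still hits \<open>a'\<close> and is blocked
  there.\<close>

lemma exposed_antichain:
  assumes a: "a \<in> exposed A t e n g s" and a': "a' \<in> exposed A t e n g s"
    and n: "1 \<le> n" and st: "s t"
    and near: "\<And>j. 8 * \<bar>drift t e n g a j - drift t e n g a' j\<bar> \<le> int n"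
    and less: "\<And>j. if s j then drift t e n g a' j < drift t e n g a j
      else drift t e n g a j < drift t e n g a' j"
  shows False
proof -
  obtain b u where bu: "exposed_ray t e n g s b u a"
    and free: "\<forall>a'\<in>A. 1 \<le> a' $ t \<longrightarrow> a' $ t < a $ t \<longrightarrow> \<not> ray_meets t e b u a'"
    using a unfolding exposed_def by blast
  have tless: "a' $ t < a $ t"
    using less[of t] st by (simp add: drift_def)
  define K where "K = real (a $ t) - real (a' $ t)"
  have K: "0 \<le> K" "8 * K \<le> real n"
    using near[of t] tless by (auto simp: K_def drift_def)
  have "ray_meets t e b u a'"
    unfolding ray_meets_def
  proof (intro allI impI)
    fix j assume j: "j \<noteq> t"
    define off where "off = b j + real (a $ t + e) * u j - real (a $ j)"
    define off' where "off' = b j + real (a' $ t + e) * u j - real (a' $ j)"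
    define dev where "dev = real n * u j - real_of_int (g j)"
    define \<Delta> where "\<Delta> = real_of_int (drift t e n g a j) - real_of_int (drift t e n g a' j)"
    have eq: "real n * off' = real n * off - K * dev + \<Delta>"
      unfolding \<Delta>_def real_drift[OF j] off_def off'_def dev_def K_def by (simp add: algebra_simps)
    have \<Delta>: "8 * \<bar>\<Delta>\<bar> \<le> real n"
    proof -
      have "real_of_int (8 * \<bar>drift t e n g a j - drift t e n g a' j\<bar>) \<le> real_of_int (int n)"
        using near[of j] by (simp only: of_int_le_iff)
      then show ?thesis
        unfolding \<Delta>_def by simp
    qed
    have "0 \<le> real n * off' \<and> real n * off' \<le> real n * 1"
    proof (cases "s j")
      case True
      then have h: "- 1 \<le> dev" "dev \<le> 0" "0 \<le> off" "off \<le> 1 / 2"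
        using bu[unfolded exposed_ray_def, rule_format, OF j] by (auto simp: off_def dev_def)
      have "K * dev \<le> 0" "- K \<le> K * dev"
        using h K mult_left_mono[of "-1" dev K] by (auto simp: mult_nonneg_nonpos)
      moreover have "0 \<le> real n * off" "real n * off \<le> real n * (1 / 2)"
        using h by (intro mult_left_mono mult_nonneg_nonneg; simp)+
      moreover have "0 \<le> \<Delta>"
        using less[of j] True unfolding \<Delta>_def by simp
      ultimately show ?thesis
        using eq \<Delta> K by linarith
    next
      case False
      then have h: "0 \<le> dev" "dev \<le> 1" "1 / 2 \<le> off" "off \<le> 1"
        using bu[unfolded exposed_ray_def, rule_format, OF j] by (auto simp: off_def dev_def)
      have "0 \<le> K * dev" "K * dev \<le> K"
        using h K mult_left_mono[of dev 1 K] by auto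
      moreover have "real n * (1 / 2) \<le> real n * off" "real n * off \<le> real n * 1"
        using h by (intro mult_left_mono; simp)+
      moreover have "\<Delta> \<le> 0"
        using less[of j] False unfolding \<Delta>_def by simp
      ultimately show ?thesis
        using eq \<Delta> K by linarith
    qed
    then have "0 \<le> off'" "off' \<le> 1"
      using n by (auto simp: zero_le_mult_iff)
    then show "real (a' $ j) \<le> b j + real (a' $ t + e) * u j \<and>
        b j + real (a' $ t + e) * u j \<le> real (a' $ j) + 1"
      by (simp add: off'_def)
  qed
  moreover have "a' \<in> A" "1 \<le> a' $ t"
    using a' by (auto simp: exposed_def)
  ultimately show False
    using free tless by blast
qed

text \<open>Different heights would make the lattice vector between the cubes a witness of
  resonance, with \<open>q\<close> the height difference and \<open>c\<close> the difference of the
  coordinates. At equal heights the transversal drifts differ by multiples of \<open>n\<close>, and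
  a difference below \<open>n / m\<close> must vanish.\<close>

lemma drift_separated:
  assumes m: "1 \<le> m" and "\<not> resonant t n g m"
    and t: "a $ t \<le> n" "a' $ t \<le> n"
    and near: "\<And>j. int m * \<bar>drift t e n g a j - drift t e n g a' j\<bar> < int n"
  shows "a = a'"
proof -
  have *: "a $ t \<le> a' $ t"
    if near: "\<And>j. int m * \<bar>drift t e n g a j - drift t e n g a' j\<bar> < int n" for a a' :: "nat ^ 'a"
  proof (rule ccontr)
    assume "\<not> a $ t \<le> a' $ t"
    then have less: "a' $ t < a $ t"
      by simp
    define q where "q = a $ t - a' $ t"
    have q: "int q = int (a $ t) - int (a' $ t)"
      using less by (simp add: q_def)
    have "int m * int q < int n"
      using near[of t] less by (simp add: drift_def q)
    then have "q * m \<le> n"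
      by (simp add: mult.commute flip: of_nat_mult)
    moreover have "1 \<le> q"
      using less by (simp add: q_def)
    moreover have "\<exists>c. int m * \<bar>int q * g j - c * int n\<bar> \<le> int n" if j: "j \<noteq> t" for j
    proof (intro exI)
      have "\<bar>int q * g j - (int (a $ j) - int (a' $ j)) * int n\<bar> = \<bar>drift t e n g a j - drift t e n g a' j\<bar>"
        using j by (simp add: drift_def q algebra_simps)
      then show "int m * \<bar>int q * g j - (int (a $ j) - int (a' $ j)) * int n\<bar> \<le> int n"
        using near[of j] by simp
    qed
    ultimately show False
      using assms(2) unfolding resonant_def by blast
  qed
  have eqt: "a $ t = a' $ t"
    using *[OF near] *[of a' a] near by (simp add: abs_minus_commute)
  show ?thesis
    unfolding vec_eq_iff
  proof
    fix j
    show "a $ j = a' $ j"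
    proof (cases "j = t")
      case False
      then have "int m * \<bar>int n * (int (a $ j) - int (a' $ j))\<bar> < int n"
        using near[of j] eqt by (simp add: drift_def algebra_simps)
      then have "int n * (int m * \<bar>int (a $ j) - int (a' $ j)\<bar>) < int n * 1"
        by (simp add: abs_mult mult_ac)
      then have "int m * \<bar>int (a $ j) - int (a' $ j)\<bar> < 1"
        by (rule mult_left_less_imp_less) simp
      moreover have "1 * \<bar>int (a $ j) - int (a' $ j)\<bar> \<le> int m * \<bar>int (a $ j) - int (a' $ j)\<bar>"
        using m by (intro mult_right_mono) auto
      ultimately have "1 * \<bar>int (a $ j) - int (a' $ j)\<bar> < 1"
        by (rule le_less_trans[rotated])
      then show ?thesis
        by simp
    qed (use eqt in simp)
  qed
qed

lemma abs_diff_less_if_div_eq: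
  fixes x y n :: int
  assumes "0 < n" "x div n = y div n"
  shows "\<bar>x - y\<bar> < n"
proof -
  have "x = n * (y div n) + x mod n" "y = n * (y div n) + y mod n"
    using assms(2) by (metis mult_div_mod_eq)+
  moreover have "0 \<le> x mod n" "x mod n < n" "0 \<le> y mod n" "y mod n < n"
    using assms(1) by auto
  ultimately show ?thesis
    by linarith
qed

lemma div_bounds_if_abs_le:
  fixes x k n :: int
  assumes "0 < n" "\<bar>x\<bar> \<le> k * n"
  shows "x div n \<in> {- k..k}"
proof -
  have "- k * n \<le> x" "x \<le> k * n"
    using assms(2) by auto
  then have "- k * n div n \<le> x div n" "x div n \<le> k * n div n"
    using zdiv_mono1 assms(1) by blast+
  then show ?thesis
    using assms(1) by (simp del: mult_minus_left)
qed

text \<open>Two points of an antichain whose coordinates differ by the same amount in every direction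
  coincide, so an antichain is determined by its projection along the diagonal.\<close>

lemma card_exposed_class_le:
  fixes A :: "(nat ^ 'd) set"
  assumes n: "1 \<le> n" and A: "\<And>a. a \<in> A \<Longrightarrow> a $ t + e \<le> n" and st: "s t"
    and m: "1 \<le> m" "\<not> resonant t n g m"
  shows "card {a \<in> exposed A t e n g s. (\<lambda>j. 8 * drift t e n g a j div int n) = \<mu>}
    \<le> (17 * m) ^ (CARD('d) - 1)"
proof -
  let ?S = "{a \<in> exposed A t e n g s. (\<lambda>j. 8 * drift t e n g a j div int n) = \<mu>}"
  \<comment> \<open>The signs turn the order of \<open>exposed_antichain\<close> into the
    componentwise one; division of \<open>w\<close> by \<open>n\<close> then cuts the drift space
    into cells of side \<open>n / m\<close>.\<close>
  define w where "w a j = int m * ((if s j then 1 else -1) * drift t e n g a j)" for a j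
  define cell where "cell a j = w a j div int n" for a j
  define \<phi> where "\<phi> a = (\<lambda>j\<in>UNIV - {t}. cell a j - cell a t)" for a
  have n': "0 < int n"
    using n by simp
  have At: "a $ t + e \<le> n" if "a \<in> ?S" for a
    using that A by (auto simp: exposed_def)
  \<comment> \<open>A strictly smaller cell index gives a strictly smaller \<open>w\<close>, and the
    common class \<open>\<mu>\<close> makes the drifts differ by less than \<open>n / 8\<close>, so
    \<open>exposed_antichain\<close> applies.\<close>
  have anti: False if "a \<in> ?S" "a' \<in> ?S" and less: "\<And>j. cell a' j < cell a j" for a a'
  proof (rule exposed_antichain[where a = a and a' = a'])
    show "a \<in> exposed A t e n g s" "a' \<in> exposed A t e n g s"
      using that by auto
    fix j
    have "8 * drift t e n g a j div int n = 8 * drift t e n g a' j div int n"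
      using that by (metis (mono_tags, lifting) mem_Collect_eq)
    then have "\<bar>8 * drift t e n g a j - 8 * drift t e n g a' j\<bar> < int n"
      by (rule abs_diff_less_if_div_eq[OF n'])
    then show "8 * \<bar>drift t e n g a j - drift t e n g a' j\<bar> \<le> int n"
      unfolding right_diff_distrib[symmetric] abs_mult by simp
    have "w a' j < w a j"
      using less[of j] zdiv_mono1[of "w a j" "w a' j" "int n"] n' by (force simp: cell_def)
    then show "if s j then drift t e n g a' j < drift t e n g a j
      else drift t e n g a j < drift t e n g a' j"
      using m by (simp add: w_def mult_less_cancel_left split: if_splits)
  qed (use n st in auto)
  have "inj_on \<phi> ?S"
  proof
    fix a a' assume S: "a \<in> ?S" "a' \<in> ?S" and eq: "\<phi> a = \<phi> a'"
    have diff: "cell a j - cell a' j = cell a t - cell a' t" for j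
    proof (cases "j = t")
      case False
      then show ?thesis
        using fun_cong[OF eq, of j] by (simp add: \<phi>_def)
    qed simp
    \<comment> \<open>If the common difference of the cell indices is nonzero, one cell is strictly
      below the other in all coordinates.\<close>
    have "cell a t = cell a' t"
    proof (rule linorder_cases)
      assume "cell a t < cell a' t"
      then have "cell a j < cell a' j" for j
        using diff[of j] by linarith
      then show ?thesis
        using anti[OF S(2,1)] by blast
    next
      assume "cell a' t < cell a t"
      then have "cell a' j < cell a j" for j
        using diff[of j] by linarith
      then show ?thesis
        using anti[OF S(1,2)] by blast
    qed
    then have same: "cell a j = cell a' j" for j
      using diff[of j] by simp
    \<comment> \<open>Two cubes in one cell have drifts closer than \<open>n / m\<close>, so
      non-resonance makes them equal.\<close>
    show "a = a'"
    proof (rule drift_separated[OF m])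
      fix j
      have "\<bar>w a j - w a' j\<bar> < int n"
        using same[of j] n' by (intro abs_diff_less_if_div_eq) (auto simp: cell_def)
      moreover have "\<bar>w a j - w a' j\<bar> = int m * \<bar>drift t e n g a j - drift t e n g a' j\<bar>"
      proof -
        have "w a j - w a' j = int m * ((if s j then 1 else -1) * (drift t e n g a j - drift t e n g a' j))"
          by (simp add: w_def algebra_simps)
        then show ?thesis
          by (simp add: abs_mult)
      qed
      ultimately show "int m * \<bar>drift t e n g a j - drift t e n g a' j\<bar> < int n"
        by simp
    qed (use At[OF S(1)] At[OF S(2)] in auto)
  qed
  have cell: "cell a j \<in> {- (4 * int m)..4 * int m}" if "a \<in> ?S" for a j
    unfolding cell_def
  proof (rule div_bounds_if_abs_le[OF n'])
    have "\<bar>w a j\<bar> = int m * \<bar>drift t e n g a j\<bar>"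
      by (simp add: w_def abs_mult)
    also have "\<dots> \<le> int m * (4 * int n)"
      using that At[OF that] by (intro mult_left_mono abs_drift_le[where A = A and s = s]) auto
    finally show "\<bar>w a j\<bar> \<le> 4 * int m * int n"
      by simp
  qed
  \<comment> \<open>Cell indices have absolute value at most \<open>4 * m\<close>, so their
    differences take at most \<open>16 * m + 1 \<le> 17 * m\<close> values.\<close>
  let ?R = "(UNIV - {t}) \<rightarrow>\<^sub>E {- (8 * int m)..8 * int m}"
  have "\<phi> a \<in> ?R" if "a \<in> ?S" for a
    unfolding \<phi>_def
  proof (intro restrict_PiE_iff[THEN iffD2] ballI)
    fix j
    show "cell a j - cell a t \<in> {- (8 * int m)..8 * int m}"
      using cell[OF that, of j] cell[OF that, of t] by auto
  qed
  then have "\<phi> ` ?S \<subseteq> ?R"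
    by blast
  then have "card ?S \<le> card ?R"
    using \<open>inj_on \<phi> ?S\<close> by (intro card_inj_on_le) (auto intro!: finite_PiE)
  also have "card ?R = card {- (8 * int m)..8 * int m} ^ (CARD('d) - 1)"
    by (subst card_PiE) (simp_all only: prod_constant card_Diff_singleton_if finite_class.finite_UNIV UNIV_I if_True finite_Diff finite)
  also have "\<dots> \<le> (17 * m) ^ (CARD('d) - 1)"
    using m(1) by (intro power_mono) auto
  finally show ?thesis .
qed

text \<open>The classes cut the range of the drifts into boxes of side \<open>n / 8\<close>, small
  enough for the antichain argument. As drifts are bounded by \<open>4 * n\<close>, each index lies
  between -32 and 32, which gives 65 values per coordinate.\<close>

lemma card_exposed_le:
  fixes A :: "(nat ^ 'd) set"
  assumes n: "1 \<le> n" and A: "\<And>a. a \<in> A \<Longrightarrow> a $ t + e \<le> n" and st: "s t"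
  shows "card (exposed A t e n g s) \<le> 65 ^ CARD('d) * (17 * resolution t n g) ^ (CARD('d) - 1)"
proof -
  let ?M = "(UNIV :: 'd set) \<rightarrow>\<^sub>E {- 32..32 :: int}"
  let ?C = "\<lambda>\<mu>. {a \<in> exposed A t e n g s. (\<lambda>j. 8 * drift t e n g a j div int n) = \<mu>}"
  have "(\<lambda>j. 8 * drift t e n g a j div int n) \<in> ?M" if "a \<in> exposed A t e n g s" for a
  proof -
    have "8 * drift t e n g a j div int n \<in> {- 32..32}" for j
    proof (rule div_bounds_if_abs_le)
      have "a $ t + e \<le> n"
        using that A by (auto simp: exposed_def)
      then show "\<bar>8 * drift t e n g a j\<bar> \<le> 32 * int n"
        using abs_drift_le[OF that, of j] by (simp add: abs_mult)
    qed (use n in simp)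
    then show ?thesis
      by (simp add: PiE_iff)
  qed
  then have "exposed A t e n g s \<subseteq> (\<Union>\<mu>\<in>?M. ?C \<mu>)"
    by (intro subsetI UN_I CollectI conjI) simp_all
  moreover have "(\<Union>\<mu>\<in>?M. ?C \<mu>) \<subseteq> exposed A t e n g s"
    by (intro UN_least) (rule Collect_subset)
  ultimately have eq: "exposed A t e n g s = (\<Union>\<mu>\<in>?M. ?C \<mu>)"
    by (rule equalityI)
  have "card (exposed A t e n g s) \<le> (\<Sum>\<mu>\<in>?M. card (?C \<mu>))"
    by (subst eq) (intro card_UN_le finite_PiE; simp)
  also have "\<dots> \<le> (\<Sum>\<mu>\<in>?M. (17 * resolution t n g) ^ (CARD('d) - 1))"
    by (intro sum_mono card_exposed_class_le n A st resolution)
  also have "\<dots> = 65 ^ CARD('d) * (17 * resolution t n g) ^ (CARD('d) - 1)"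
    by (simp add: card_PiE)
  finally show ?thesis .
qed

section \<open>Summation over all buckets and axes\<close>

lemma card_seen_le:
  fixes A :: "(nat ^ 'd) set" and t :: 'd
  assumes n: "1 \<le> n" and A: "\<And>a. a \<in> A \<Longrightarrow> a $ t + e \<le> n" and fin: "finite A"
  shows "real (card (seen A t e))
    \<le> real CARD('d \<Rightarrow> bool) * 65 ^ CARD('d) * 17 ^ (CARD('d) - 1) * (3 * 42 ^ (CARD('d) - 1))
      * real n powr (real CARD('d) - 1 / real CARD('d))"
proof -
  let ?E = "\<lambda>g. \<Union>s\<in>{s. s t}. exposed A t e n g s"
  let ?b = "\<lambda>g. 65 ^ CARD('d) * (17 * resolution t n g) ^ (CARD('d) - 1)"
  \<comment> \<open>The number of half patterns \<open>s\<close> is bounded in terms of the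
    dimension alone, so it only enters the constant.\<close>
  have E: "card (?E g) \<le> CARD('d \<Rightarrow> bool) * ?b g" for g
  proof -
    have "card (?E g) \<le> (\<Sum>s\<in>{s. s t}. card (exposed A t e n g s))"
      by (intro card_UN_le) simp
    also have "\<dots> \<le> (\<Sum>s\<in>{s :: 'd \<Rightarrow> bool. s t}. ?b g)"
      using card_exposed_le[OF n A] by (intro sum_mono) auto
    also have "\<dots> = card {s :: 'd \<Rightarrow> bool. s t} * ?b g"
      by simp
    also have "\<dots> \<le> CARD('d \<Rightarrow> bool) * ?b g"
      by (intro mult_right_mono card_mono) auto
    finally show ?thesis .
  qed
  have "exposed A t e n g s \<subseteq> A" for g s
    by (auto simp: exposed_def)
  then have "finite (exposed A t e n g s)" for g s
    using fin by (rule finite_subset)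
  then have "card (seen A t e) \<le> card (\<Union>g\<in>bucket_grid t n. ?E g)"
    by (intro card_mono seen_subset_exposed) (auto simp: finite_bucket_grid)
  also have "\<dots> \<le> (\<Sum>g\<in>bucket_grid t n. card (?E g))"
    by (intro card_UN_le finite_bucket_grid)
  also have "\<dots> \<le> (\<Sum>g\<in>bucket_grid t n. CARD('d \<Rightarrow> bool) * ?b g)"
    by (intro sum_mono E)
  finally have "real (card (seen A t e)) \<le> real (\<Sum>g\<in>bucket_grid t n. CARD('d \<Rightarrow> bool) * ?b g)"
    by (simp only: of_nat_le_iff)
  also have "\<dots> = real CARD('d \<Rightarrow> bool) * 65 ^ CARD('d) * 17 ^ (CARD('d) - 1)
      * (\<Sum>g\<in>bucket_grid t n. real (resolution t n g) ^ (CARD('d) - 1))"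
    by (simp add: sum_distrib_left power_mult_distrib mult_ac)
  also have "\<dots> \<le> real CARD('d \<Rightarrow> bool) * 65 ^ CARD('d) * 17 ^ (CARD('d) - 1)
      * (3 * 42 ^ (CARD('d) - 1) * real n powr (real CARD('d) - 1 / real CARD('d)))"
    by (intro mult_left_mono sum_power_resolution_powr_le n) auto
  finally show ?thesis
    by (simp only: mult.assoc)
qed

lemma finite_nat_vecs_less: "finite {a :: nat ^ 'd. \<forall>i. a $ i < n}"
proof (rule finite_subset)
  show "{a :: nat ^ 'd. \<forall>i. a $ i < n} \<subseteq> vec_lambda ` (UNIV \<rightarrow>\<^sub>E {..<n})"
  proof
    fix a :: "nat ^ 'd" assume "a \<in> {a. \<forall>i. a $ i < n}"
    then show "a \<in> vec_lambda ` (UNIV \<rightarrow>\<^sub>E {..<n})"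
      by (intro image_eqI[of _ _ "vec_nth a"]) auto
  qed
qed (simp add: finite_PiE)

text \<open>Layer 0 in direction \<open>t\<close> is not covered by \<open>seen\<close>. Its cubes
  are determined by the other coordinates, so a trivial count suffices.\<close>

lemma card_nat_vecs_less_zero_at:
  fixes t :: "'d::finite"
  shows "card {a :: nat ^ 'd. (\<forall>i. a $ i < n) \<and> a $ t = 0} \<le> n ^ (CARD('d) - 1)"
proof -
  have "inj_on (\<lambda>a. \<lambda>i\<in>UNIV - {t}. a $ i) {a :: nat ^ 'd. (\<forall>i. a $ i < n) \<and> a $ t = 0}"
  proof
    fix a a' :: "nat ^ 'd"
    assume "a \<in> {a. (\<forall>i. a $ i < n) \<and> a $ t = 0}" "a' \<in> {a. (\<forall>i. a $ i < n) \<and> a $ t = 0}"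
      and eq: "(\<lambda>i\<in>UNIV - {t}. a $ i) = (\<lambda>i\<in>UNIV - {t}. a' $ i)"
    then have "a $ t = a' $ t"
      by simp
    moreover have "a $ i = a' $ i" if "i \<noteq> t" for i
      using fun_cong[OF eq, of i] that by simp
    ultimately show "a = a'"
      unfolding vec_eq_iff by metis
  qed
  moreover have "(\<lambda>a. \<lambda>i\<in>UNIV - {t}. a $ i) ` {a :: nat ^ 'd. (\<forall>i. a $ i < n) \<and> a $ t = 0}
    \<subseteq> (UNIV - {t}) \<rightarrow>\<^sub>E {..<n}"
    by (intro image_subsetI, unfold restrict_PiE_iff) simp
  ultimately have "card {a :: nat ^ 'd. (\<forall>i. a $ i < n) \<and> a $ t = 0} \<le> card ((UNIV - {t}) \<rightarrow>\<^sub>E {..<n})"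
    by (intro card_inj_on_le) (auto intro!: finite_PiE)
  also have "\<dots> = n ^ (CARD('d) - 1)"
    by (subst card_PiE) (simp_all only: prod_constant card_Diff_singleton_if finite_class.finite_UNIV UNIV_I if_True finite_Diff finite card_lessThan)
  finally show ?thesis .
qed

theorem theorem8p1:
  assumes "CARD('d::finite) > 2"
  shows "\<exists>C::real. \<forall>n::nat. \<forall>Obs :: (real ^ 'd) set set.
           n \<ge> 2 \<and> Obs \<subseteq> cube_partition n - {observer_cube} \<longrightarrow>
           real (card {Q \<in> Obs. visible (pi / 4) Obs Q})
             \<le> C * real n powr (real CARD('d) - 1 / real CARD('d)) * ln (real n)"
proof -
  let ?p = "real CARD('d) - 1 / real CARD('d)"
  let ?K = "real CARD('d \<Rightarrow> bool) * 65 ^ CARD('d) * 17 ^ (CARD('d) - 1) * (3 * 42 ^ (CARD('d) - 1))"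
  \<comment> \<open>For each axis, the 1 accounts for layer 0 and the two \<open>?K\<close> for the
    bottom and top facets.\<close>
  let ?C = "real CARD('d) * (1 + 2 * ?K)"
  \<comment> \<open>Dividing the constant by \<open>ln 2\<close> brings in the logarithm, since
    \<open>1 \<le> ln n / ln 2\<close>.\<close>
  have "real (card {Q \<in> Obs. visible (pi / 4) Obs Q}) \<le> ?C / ln 2 * real n powr ?p * ln (real n)"
    if n: "n \<ge> 2" and Obs: "Obs \<subseteq> cube_partition n - {observer_cube}"
    for n :: nat and Obs :: "(real ^ 'd) set set"
  proof -
    define A where "A = {a :: nat ^ 'd. (\<forall>i. a $ i < n) \<and> unit_cube a \<in> Obs}"
    have ObsA: "Obs = unit_cube ` A"
      using Obs by (auto simp: A_def cube_partition_def)
    have finA: "finite A"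
      by (rule finite_subset[OF _ finite_nat_vecs_less[of n]]) (auto simp: A_def)
    have sub: "seen A t e \<subseteq> A" for t e
      by (auto simp: seen_def)
    let ?Z = "\<lambda>t. {a :: nat ^ 'd. (\<forall>i. a $ i < n) \<and> a $ t = 0}"
    let ?V = "\<lambda>t. ?Z t \<union> (seen A t 0 \<union> seen A t 1)"
    have finV: "finite (?V t)" for t
      using finite_subset[OF sub finA] finite_subset[OF _ finite_nat_vecs_less[of n], of "?Z t"] by auto
    have "{Q \<in> Obs. visible (pi / 4) Obs Q} \<subseteq> unit_cube ` (\<Union>t. ?V t)"
    proof
      fix Q assume "Q \<in> {Q \<in> Obs. visible (pi / 4) Obs Q}"
      then obtain a where a: "a \<in> A" "Q = unit_cube a" "visible (pi / 4) (unit_cube ` A) (unit_cube a)"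
        unfolding ObsA by blast
      then have "a \<in> (\<Union>t. ?V t)"
        using visible_imp_seen[OF a(3,1)] by (auto simp: A_def)
      then show "Q \<in> unit_cube ` (\<Union>t. ?V t)"
        using a(2) by blast
    qed
    then have "card {Q \<in> Obs. visible (pi / 4) Obs Q} \<le> card (\<Union>t. ?V t)"
      using finV by (intro surj_card_le) auto
    also have "\<dots> \<le> (\<Sum>t\<in>UNIV. card (?V t))"
      by (intro card_UN_le) simp
    finally have "real (card {Q \<in> Obs. visible (pi / 4) Obs Q}) \<le> (\<Sum>t\<in>UNIV. real (card (?V t)))"
      by (simp only: of_nat_le_iff flip: of_nat_sum)
    also have "\<dots> \<le> (\<Sum>t\<in>(UNIV :: 'd set). (1 + 2 * ?K) * real n powr ?p)"
    proof (intro sum_mono)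
      fix t :: 'd
      have "card (?V t) \<le> card (?Z t) + (card (seen A t 0) + card (seen A t 1))"
        by (intro order_trans[OF card_Un_le] add_left_mono card_Un_le)
      then have "real (card (?V t)) \<le> real (card (?Z t)) + (real (card (seen A t 0)) + real (card (seen A t 1)))"
        by linarith
      also have "real (card (?Z t)) \<le> real n powr ?p"
      proof -
        have "real (card (?Z t)) \<le> real (n ^ (CARD('d) - 1))"
          using card_nat_vecs_less_zero_at[of n t] by (simp only: of_nat_le_iff)
        also have "\<dots> = real n powr real (CARD('d) - 1)"
          using n by (subst powr_realpow) simp_all
        \<comment> \<open>The exponents compare because \<open>1 / d \<le> 1\<close>.\<close>
        also have "\<dots> \<le> real n powr ?p"
          using n assms by (intro powr_mono) (auto simp: of_nat_diff)
        finally show ?thesis .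
      qed
      also have "real (card (seen A t e)) \<le> ?K * real n powr ?p" if "e \<le> 1" for e
      proof (rule card_seen_le)
        fix a assume "a \<in> A"
        then have "a $ t < n"
          by (simp add: A_def)
        then show "a $ t + e \<le> n"
          using that by simp
      qed (use n finA in auto)
      from add_mono[OF this[of 0] this[of 1]]
      have "real (card (seen A t 0)) + real (card (seen A t 1)) \<le> 2 * (?K * real n powr ?p)"
        by (simp only: mult_2)
      finally show "real (card (?V t)) \<le> (1 + 2 * ?K) * real n powr ?p"
        unfolding distrib_right mult_1 by simp
    qed
    also have "\<dots> = ?C * real n powr ?p * 1"
      by simp
    also have "\<dots> \<le> ?C * real n powr ?p * (ln (real n) / ln 2)"
      using n by (intro mult_left_mono) (simp_all add: le_divide_eq)
    finally show ?thesis
      by simp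
  qed
  then show ?thesis
    by blast
qed

end
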